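(* Let $n\ge 5$ and $3\le i\le n-1$. Then $$\mathcal{D}_n^{\{0,i\}}(x)=\prod_{j=4}^n\left(1+(-1)^{j-1}x^{\left\lfloor\frac{j}{2}\right\rfloor}\right)^2$$ and $$\mathcal{D}_n^{\{0,1,i\}}(x)=(1-x^4)\prod_{j=5}^n\left(1+(-1)^{j-1}x^{\left\lfloor\frac{j}{2}\right\rfloor}\right)^2.$$
   Context: Let $[n]=\{1,\dots,n\}$. A signed permutation of degree $n$ is a bijection $\sigma$ of $\{\pm1,\dots,\pm n\}$ with $\sigma(-i)=-\sigma(i)$; $\mathcal{D}_n$ is the group of signed permutations of degree $n$ with an even number of negative entries among $\sigma(1),\dots,\sigma(n)$. For $\sigma\in\mathcal{D}_n$, the Coxeter length is $\ell(\sigma)=|\{(i,j)\in[n]^2: i<j,\ \sigma(i)>\sigma(j)\}|+|\{(i,j)\in[n]^2: i<j,\ \sigma(i)+\sigma(j)<0\}|$, and the odd length is $L(\sigma)=|\{(i,j)\in[n]^2: i<j,\ \sigma(i)>\sigma(j),\ i\not\equiv j\ (\mathrm{mod}\ 2)\}|+|\{(i,j)\in[n]^2: i<j,\ \sigma(i)+\sigma(j)<0,\ i\not\equiv j\ (\mathrm{mod}\ 2)\}|$. For $I\subseteq\{0,1,\dots,n-1\}$, $\mathcal{D}_n^I=\{\sigma\in\mathcal{D}_n:\sigma(i)<\sigma(i+1)\text{ for all } i\in I\}$ with the convention $\sigma(0):=-\sigma(2)$, and $\mathcal{D}_n^I(x)=\sum_{\sigma\in\mathcal{D}_n^I}(-1)^{\ell(\sigma)}x^{L(\sigma)}$.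 *)

theory Defs
  imports "HOL-Combinatorics.Permutations" "HOL-Computational_Algebra.Polynomial"
begin

text \<open>
  A signed permutation of degree \<open>n\<close> is encoded as a function on all integers that permutes
  \<open>{-n..n} - {0}\<close>. The predicate \<open>permutes\<close> makes it the identity elsewhere, so every signed
  permutation has exactly one representing function and the sets below are finite.
\<close>

definition signed_perms :: "nat \<Rightarrow> (int \<Rightarrow> int) set" where
  "signed_perms n =
     {\<sigma>. \<sigma> permutes ({- int n..int n} - {0}) \<and>
          (\<forall>i \<in> {- int n..int n} - {0}. \<sigma> (- i) = - \<sigma> i)}"

definition even_signed_perms :: "nat \<Rightarrow> (int \<Rightarrow> int) set" where
  "even_signed_perms n =
     {\<sigma> \<in> signed_perms n. even (card {i \<in> {1..int n}. \<sigma> i < 0})}"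

definition coxeter_length :: "nat \<Rightarrow> (int \<Rightarrow> int) \<Rightarrow> nat" where
  "coxeter_length n \<sigma> =
     card {(i, j) \<in> {1..int n} \<times> {1..int n}. i < j \<and> \<sigma> i > \<sigma> j} +
     card {(i, j) \<in> {1..int n} \<times> {1..int n}. i < j \<and> \<sigma> i + \<sigma> j < 0}"

definition odd_length :: "nat \<Rightarrow> (int \<Rightarrow> int) \<Rightarrow> nat" where
  "odd_length n \<sigma> =
     card {(i, j) \<in> {1..int n} \<times> {1..int n}.
             i < j \<and> \<sigma> i > \<sigma> j \<and> i mod 2 \<noteq> j mod 2} +
     card {(i, j) \<in> {1..int n} \<times> {1..int n}.
             i < j \<and> \<sigma> i + \<sigma> j < 0 \<and> i mod 2 \<noteq> j mod 2}"

text \<open>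
  The value at position \<open>i\<close> with the type \<open>D\<close> convention \<open>\<sigma>(0) = - \<sigma>(2)\<close>; the encoding itself
  has \<open>\<sigma> 0 = 0\<close>, which is never used.
\<close>

definition value_at :: "(int \<Rightarrow> int) \<Rightarrow> nat \<Rightarrow> int" where
  "value_at \<sigma> i = (if i = 0 then - \<sigma> 2 else \<sigma> (int i))"

definition D_quotient :: "nat \<Rightarrow> nat set \<Rightarrow> (int \<Rightarrow> int) set" where
  "D_quotient n I =
     {\<sigma> \<in> even_signed_perms n. \<forall>i \<in> I. value_at \<sigma> i < value_at \<sigma> (i + 1)}"

definition D_gf :: "nat \<Rightarrow> nat set \<Rightarrow> int poly" where
  "D_gf n I =
     (\<Sum>\<sigma> \<in> D_quotient n I. monom ((- 1) ^ coxeter_length n \<sigma>) (odd_length n \<sigma>))"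

end

theory Submission
  imports Defs
begin

text \<open>
  The signed weight of \<open>\<sigma>\<close> is a product over the pairs of positions, and the sums are taken over all
  signed permutations, which doubles them. If \<open>\<sigma>(k + 1)\<close> is extremal among the entries at \<open>k\<close>,
  \<open>k + 1\<close>, \<open>k + 2\<close>, then exchanging \<open>\<sigma>(k)\<close> and \<open>\<sigma>(k + 2)\<close> negates the weight. This cancellation
  shows that an ascent condition at \<open>k\<close> may be moved to \<open>k + 1\<close> (both sums reduce to
  \<open>\<sigma>(k) < \<sigma>(k + 1) < \<sigma>(k + 2)\<close>), and that in the sum over the whole group the largest absolute
  value only occurs at the first and the last position, which gives a recursion in \<open>n\<close>.

  Next, let \<open>J\<close> be a condition on the positions \<open>\<ge> 4\<close> only. Sign changes of the first three entries
  affect only the pairs among them, so cancellation reduces the sums over \<open>J\<close>, \<open>J \<union> {0}\<close> and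
  \<open>J \<union> {0, 1}\<close> to the sum over \<open>\<bar>\<sigma>(1)\<bar> < \<sigma>(2) < \<sigma>(3)\<close>, with factors \<open>(1 - x\<^sup>2)\<^sup>2\<close>, \<open>1 - x\<^sup>2\<close> and
  \<open>1 + x\<^sup>2\<close>. Using this for \<open>J = \<emptyset>\<close> and \<open>J = {4}\<close> expresses both required sums through the total.
\<close>

section \<open>The signed weight as a product over pairs of positions\<close>

definition pair_count :: "int \<Rightarrow> int \<Rightarrow> nat" where
  "pair_count a b = of_bool (a > b) + of_bool (a + b < 0)"

text \<open>Negating \<open>a\<close> exchanges the two conditions that are counted. Hence the sign
  of an entry is felt only by the pairs in which it stands on the right.\<close>

lemma pair_count_minus [simp]: "pair_count (- a) b = pair_count a b"
  by (auto simp: pair_count_def)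

lemma pair_count_abs_less:
  "\<bar>a\<bar> < b \<Longrightarrow> pair_count a b = 0"
  "\<bar>a\<bar> < b \<Longrightarrow> pair_count a (- b) = 2"
  "\<bar>b\<bar> < \<bar>a\<bar> \<Longrightarrow> pair_count a b = 1"
  by (auto simp: pair_count_def)

text \<open>The argument is \<open>k = i + j\<close>, odd exactly when the positions differ in
  parity. Each inversion of such a pair enters both lengths, whence -x; otherwise it enters only the
  Coxeter length, whence -1.\<close>

definition pair_weight :: "int \<Rightarrow> int poly" where
  "pair_weight k = (if odd k then monom (- 1) 1 else - 1)"

definition index_pairs :: "nat \<Rightarrow> (int \<times> int) set" where
  "index_pairs n = {(i, j). 1 \<le> i \<and> i < j \<and> j \<le> int n}"

text \<open>This is the summand of \<open>D_gf\<close>, by \<open>monom_coxeter_odd_length\<close>.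
  The product form shows which factors change when positions are rearranged.\<close>

definition weight :: "nat \<Rightarrow> (int \<Rightarrow> int) \<Rightarrow> int poly" where
  "weight n \<sigma> = (\<Prod>(i, j)\<in>index_pairs n. pair_weight (i + j) ^ pair_count (\<sigma> i) (\<sigma> j))"

definition weight_sum :: "nat \<Rightarrow> ((int \<Rightarrow> int) \<Rightarrow> bool) \<Rightarrow> int poly" where
  "weight_sum n P = (\<Sum>\<sigma> | \<sigma> \<in> signed_perms n \<and> P \<sigma>. weight n \<sigma>)"

section \<open>Finiteness and group structure of the signed permutations\<close>

lemma finite_index_pairs [simp]: "finite (index_pairs n)"
  by (rule finite_subset[of _ "{1..int n} \<times> {1..int n}"]) (auto simp: index_pairs_def)

lemma finite_signed_perms [simp]: "finite (signed_perms n)"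
  by (rule finite_subset[OF _ finite_permutations[of "{- int n..int n} - {0}"]])
     (auto simp: signed_perms_def)

lemma signed_perms_minus:
  assumes "\<sigma> \<in> signed_perms n"
  shows "\<sigma> (- i) = - \<sigma> i"
proof (cases "i \<in> {- int n..int n} - {0}")
  case True
  then show ?thesis using assms by (auto simp: signed_perms_def)
next
  case False
  moreover from False have "- i \<notin> {- int n..int n} - {0}" by auto
  ultimately show ?thesis
    using assms unfolding signed_perms_def mem_Collect_eq by (metis permutes_not_in)
qed

lemma signed_perms_inj:
  assumes "\<sigma> \<in> signed_perms n"
  shows "\<sigma> i = \<sigma> j \<longleftrightarrow> i = j"
  using assms by (auto simp: signed_perms_def dest: permutes_inj injD)

lemma signed_perms_range:
  assumes "\<sigma> \<in> signed_perms n" "1 \<le> i" "i \<le> int n"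
  shows "\<sigma> i \<noteq> 0" "\<bar>\<sigma> i\<bar> \<le> int n"
proof -
  have "\<sigma> i \<in> {- int n..int n} - {0}"
    using assms permutes_in_image[of \<sigma> "{- int n..int n} - {0}" i]
    by (auto simp: signed_perms_def)
  then show "\<sigma> i \<noteq> 0" "\<bar>\<sigma> i\<bar> \<le> int n" by auto
qed

lemma signed_perms_abs_inj:
  assumes "\<sigma> \<in> signed_perms n" "1 \<le> i" "1 \<le> j" "i \<noteq> j"
  shows "\<bar>\<sigma> i\<bar> \<noteq> \<bar>\<sigma> j\<bar>"
proof
  assume "\<bar>\<sigma> i\<bar> = \<bar>\<sigma> j\<bar>"
  then have "\<sigma> i = \<sigma> j \<or> \<sigma> i = \<sigma> (- j)"
    using signed_perms_minus[OF assms(1), of j] by linarith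
  then show False using signed_perms_inj[OF assms(1)] assms by auto
qed

lemma signed_perms_comp:
  assumes "\<sigma> \<in> signed_perms n" "g \<in> signed_perms n"
  shows "\<sigma> \<circ> g \<in> signed_perms n"
proof -
  have "\<sigma> \<circ> g permutes ({- int n..int n} - {0})"
    using assms permutes_compose by (auto simp: signed_perms_def)
  moreover have "(\<sigma> \<circ> g) (- i) = - (\<sigma> \<circ> g) i" for i
    using assms by (simp add: signed_perms_minus)
  ultimately show ?thesis by (simp add: signed_perms_def)
qed

lemma signed_perms_inv:
  assumes "g \<in> signed_perms n"
  shows "inv g \<in> signed_perms n"
proof -
  have p: "g permutes ({- int n..int n} - {0})" using assms by (simp add: signed_perms_def)
  have "inv g (- i) = - inv g i" for i
  proof -
    have "g (inv g (- i)) = g (- inv g i)"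
      using p signed_perms_minus[OF assms] by (simp add: permutes_inverses)
    then show ?thesis using signed_perms_inj[OF assms] by blast
  qed
  then show ?thesis using permutes_inv[OF p] by (simp add: signed_perms_def)
qed

section \<open>Reindexing and cancellation of weight sums\<close>

lemma weight_sum_transport:
  assumes g: "g \<in> signed_perms n"
    and Q: "\<And>\<sigma>. \<sigma> \<in> signed_perms n \<Longrightarrow> Q (\<sigma> \<circ> g) \<longleftrightarrow> P \<sigma>"
    and w: "\<And>\<sigma>. \<sigma> \<in> signed_perms n \<Longrightarrow> P \<sigma> \<Longrightarrow> weight n (\<sigma> \<circ> g) = c * weight n \<sigma>"
  shows "weight_sum n Q = c * weight_sum n P"
proof -
  have p: "g permutes ({- int n..int n} - {0})" using g by (simp add: signed_perms_def)
  have gi: "g \<circ> inv g = id" "inv g \<circ> g = id" using permutes_inv_o[OF p] by auto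
  have "weight_sum n Q = (\<Sum>\<sigma> | \<sigma> \<in> signed_perms n \<and> P \<sigma>. weight n (\<sigma> \<circ> g))"
    unfolding weight_sum_def
  proof (rule sum.reindex_bij_witness[where i = "\<lambda>\<sigma>. \<sigma> \<circ> g" and j = "\<lambda>\<sigma>. \<sigma> \<circ> inv g"])
    fix \<sigma> assume "\<sigma> \<in> {\<sigma>. \<sigma> \<in> signed_perms n \<and> Q \<sigma>}"
    then have s: "\<sigma> \<in> signed_perms n" "Q \<sigma>" by auto
    show 1: "(\<sigma> \<circ> inv g) \<circ> g = \<sigma>" by (simp add: comp_assoc gi)
    have s2: "\<sigma> \<circ> inv g \<in> signed_perms n"
      by (rule signed_perms_comp[OF s(1) signed_perms_inv[OF g]])
    show "\<sigma> \<circ> inv g \<in> {\<sigma>. \<sigma> \<in> signed_perms n \<and> P \<sigma>}"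
      using Q[OF s2] 1 s s2 by simp
    show "weight n ((\<sigma> \<circ> inv g) \<circ> g) = weight n \<sigma>" using 1 by simp
  next
    fix \<sigma> assume "\<sigma> \<in> {\<sigma>. \<sigma> \<in> signed_perms n \<and> P \<sigma>}"
    then show "(\<sigma> \<circ> g) \<circ> inv g = \<sigma>" "\<sigma> \<circ> g \<in> {\<sigma>. \<sigma> \<in> signed_perms n \<and> Q \<sigma>}"
      using Q signed_perms_comp[OF _ g] by (auto simp: comp_assoc gi)
  qed
  also have "\<dots> = c * weight_sum n P"
    unfolding weight_sum_def sum_distrib_left using w by (intro sum.cong) auto
  finally show ?thesis .
qed

text \<open>The reindexed sum is its own negative, and \<open>int poly\<close> has no 2-torsion. All
  sign-reversing arguments below take this form.\<close>

lemma weight_sum_cancel: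
  assumes "g \<in> signed_perms n"
    and "\<And>\<sigma>. \<sigma> \<in> signed_perms n \<Longrightarrow> P (\<sigma> \<circ> g) \<longleftrightarrow> P \<sigma>"
    and "\<And>\<sigma>. \<sigma> \<in> signed_perms n \<Longrightarrow> P \<sigma> \<Longrightarrow> weight n (\<sigma> \<circ> g) = - weight n \<sigma>"
  shows "weight_sum n P = 0"
  using weight_sum_transport[of g n P P "- 1"] assms by simp

lemma weight_sum_cong:
  assumes "\<And>\<sigma>. \<sigma> \<in> signed_perms n \<Longrightarrow> P \<sigma> \<longleftrightarrow> Q \<sigma>"
  shows "weight_sum n P = weight_sum n Q"
  unfolding weight_sum_def using assms by (intro sum.cong) auto

lemma weight_sum_disj:
  assumes "\<And>\<sigma>. \<sigma> \<in> signed_perms n \<Longrightarrow> P \<sigma> \<longleftrightarrow> Q \<sigma> \<or> R \<sigma>"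
    and "\<And>\<sigma>. \<sigma> \<in> signed_perms n \<Longrightarrow> \<not> (Q \<sigma> \<and> R \<sigma>)"
  shows "weight_sum n P = weight_sum n Q + weight_sum n R"
proof -
  have "{\<sigma>. \<sigma> \<in> signed_perms n \<and> P \<sigma>} =
      {\<sigma>. \<sigma> \<in> signed_perms n \<and> Q \<sigma>} \<union> {\<sigma>. \<sigma> \<in> signed_perms n \<and> R \<sigma>}"
    using assms(1) by auto
  then show ?thesis unfolding weight_sum_def
    using assms(2) by (simp add: sum.union_disjoint disjoint_iff)
qed

section \<open>Sign change of a single entry\<close>

definition flip :: "int \<Rightarrow> int \<Rightarrow> int" where
  "flip k = transpose k (- k)"

lemma flip_signed_perms:
  assumes "1 \<le> k" "k \<le> int n"
  shows "flip k \<in> signed_perms n"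
  unfolding signed_perms_def flip_def mem_Collect_eq
proof
  show "transpose k (- k) permutes ({- int n..int n} - {0})"
    by (rule permutes_swap_id) (use assms in auto)
qed (use assms in \<open>auto simp: transpose_def\<close>)

lemma comp_flip [simp]:
  assumes "\<sigma> \<in> signed_perms n" "1 \<le> k" "1 \<le> i"
  shows "(\<sigma> \<circ> flip k) i = (if i = k then - \<sigma> k else \<sigma> i)"
  using assms by (auto simp: flip_def transpose_def signed_perms_minus)

text \<open>By \<open>pair_count_minus\<close>, the pairs with left position k do not notice the
  sign change, so only the pairs (i, k) with i < k are affected. The common factor \<open>r\<close>
  collects all others.\<close>

lemma weight_flip:
  assumes s: "\<sigma> \<in> signed_perms n" and k: "1 \<le> k" "k \<le> int n"
  shows "\<exists>r. weight n \<sigma> = r * (\<Prod>i\<in>{1..<k}. pair_weight (i + k) ^ pair_count (\<sigma> i) (\<sigma> k)) \<and>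
    weight n (\<sigma> \<circ> flip k) =
      r * (\<Prod>i\<in>{1..<k}. pair_weight (i + k) ^ pair_count (\<sigma> i) (- \<sigma> k))"
proof -
  let ?A = "{(i, j). (i, j) \<in> index_pairs n \<and> j \<noteq> k}"
  let ?B = "(\<lambda>i. (i, k)) ` {1..<k}"
  have fA: "finite ?A" by (rule finite_subset[OF _ finite_index_pairs[of n]]) auto
  have T: "index_pairs n = ?A \<union> ?B" "?A \<inter> ?B = {}"
    using k by (auto simp: index_pairs_def)
  have split: "weight n \<rho> =
      (\<Prod>(i, j)\<in>?A. pair_weight (i + j) ^ pair_count (\<rho> i) (\<rho> j)) *
      (\<Prod>i\<in>{1..<k}. pair_weight (i + k) ^ pair_count (\<rho> i) (\<rho> k))" for \<rho>
  proof -
    have "inj_on (\<lambda>i. (i, k)) {1..<k}" by (auto simp: inj_on_def)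
    then show ?thesis
      unfolding weight_def by (subst T(1)) (simp add: prod.union_disjoint[OF fA _ T(2)] prod.reindex)
  qed
  have "(\<Prod>(i, j)\<in>?A. pair_weight (i + j) ^ pair_count ((\<sigma> \<circ> flip k) i) ((\<sigma> \<circ> flip k) j)) =
      (\<Prod>(i, j)\<in>?A. pair_weight (i + j) ^ pair_count (\<sigma> i) (\<sigma> j))"
    by (rule prod.cong) (use s k in \<open>auto simp: index_pairs_def simp del: o_apply\<close>)
  moreover have "(\<Prod>i\<in>{1..<k}. pair_weight (i + k) ^ pair_count ((\<sigma> \<circ> flip k) i) ((\<sigma> \<circ> flip k) k)) =
      (\<Prod>i\<in>{1..<k}. pair_weight (i + k) ^ pair_count (\<sigma> i) (- \<sigma> k))"
    by (rule prod.cong) (use s k in \<open>auto simp del: o_apply\<close>)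
  ultimately show ?thesis using split[of \<sigma>] split[of "\<sigma> \<circ> flip k"] by auto
qed

section \<open>Exchange of two positions at distance two, and moving an ascent\<close>

definition odd_extension :: "(int \<Rightarrow> int) \<Rightarrow> int \<Rightarrow> int" where
  "odd_extension p j = (if j < 0 then - p (- j) else p j)"

lemma odd_extension_signed_perms:
  assumes p: "p permutes {1..int n}"
  shows "odd_extension p \<in> signed_perms n"
proof -
  let ?g = "odd_extension p" and ?h = "odd_extension (inv p)"
  \<comment> \<open>A permutation of {1..n} preserves the sign of every integer, so the odd
    extensions of \<open>p\<close> and \<open>inv p\<close> are mutually inverse.\<close>
  have pos: "q j > 0 \<longleftrightarrow> j > 0" "q j < 0 \<longleftrightarrow> j < 0"
    if "q permutes {1..int n}" for q j
    using permutes_in_image[OF that, of j] permutes_not_in[OF that, of j] by force+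
  have q: "inv p permutes {1..int n}" by (rule permutes_inv[OF p])
  have inv: "p (inv p j) = j" "inv p (p j) = j" for j
    using permutes_inverses[OF p] by auto
  have gh: "?g (?h j) = j" "?h (?g j) = j" for j
    using pos[OF p, of j] pos[OF p, of "- j"] pos[OF q, of j] pos[OF q, of "- j"] inv
    by (auto simp: odd_extension_def)
  have "?g permutes ({- int n..int n} - {0})"
    unfolding permutes_def
  proof (intro conjI allI impI)
    fix j assume j: "j \<notin> {- int n..int n} - {0}"
    have "p 0 = 0" using permutes_not_in[OF p, of 0] by simp
    then show "?g j = j" using j permutes_not_in[OF p, of j] permutes_not_in[OF p, of "- j"]
      by (cases "j = 0") (auto simp: odd_extension_def)
  next
    fix j show "\<exists>!i. ?g i = j" using gh by metis
  qed
  moreover have "?g (- i) = - ?g i" if "i \<noteq> 0" for i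
    using that by (auto simp: odd_extension_def)
  ultimately show ?thesis by (simp add: signed_perms_def)
qed

text \<open>Distance two keeps the parity of every position, hence every \<open>pair_weight\<close>,
  and leaves a single position in between.\<close>

definition swap2 :: "int \<Rightarrow> int \<Rightarrow> int" where
  "swap2 k = odd_extension (transpose k (k + 2))"

lemma swap2_signed_perms:
  assumes "1 \<le> k" "k + 2 \<le> int n"
  shows "swap2 k \<in> signed_perms n"
  unfolding swap2_def
  by (rule odd_extension_signed_perms, rule permutes_swap_id) (use assms in auto)

lemma swap2_apply [simp]:
  "1 \<le> i \<Longrightarrow> swap2 k i = (if i = k then k + 2 else if i = k + 2 then k else i)"
  by (auto simp: swap2_def odd_extension_def transpose_def)

lemma pair_weight_cong: "even (k - l) \<Longrightarrow> pair_weight k = pair_weight l"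
  by (auto simp: pair_weight_def)

text \<open>The part of the weight inside a window of three consecutive positions. It is the same
  for every window: neighbours have odd index sum, the outer pair an even one.\<close>

definition triple_weight :: "int \<Rightarrow> int \<Rightarrow> int \<Rightarrow> int poly" where
  "triple_weight a b c =
     monom (- 1) 1 ^ (pair_count a b + pair_count b c) * (- 1) ^ pair_count a c"

text \<open>Outside the window's three pairs, \<open>swap2 k\<close> permutes the pairs i < j,
  keeping their order and the parity of i + j. These factors form \<open>r\<close>.\<close>

lemma weight_swap2:
  assumes k: "1 \<le> k" "k + 2 \<le> int n"
  shows "\<exists>r. weight n \<sigma> = r * triple_weight (\<sigma> k) (\<sigma> (k + 1)) (\<sigma> (k + 2)) \<and>
    weight n (\<sigma> \<circ> swap2 k) = r * triple_weight (\<sigma> (k + 2)) (\<sigma> (k + 1)) (\<sigma> k)"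
proof -
  let ?B = "{(k, k + 1), (k, k + 2), (k + 1, k + 2)}"
  let ?A = "index_pairs n - ?B"
  let ?f = "\<lambda>(i, j). (swap2 k i, swap2 k j)"
  have sub: "?B \<subseteq> index_pairs n" using k by (auto simp: index_pairs_def)
  have split: "weight n \<rho> = (\<Prod>(i, j)\<in>?A. pair_weight (i + j) ^ pair_count (\<rho> i) (\<rho> j)) *
      triple_weight (\<rho> k) (\<rho> (k + 1)) (\<rho> (k + 2))" for \<rho>
  proof -
    have "(\<Prod>(i, j)\<in>?B. pair_weight (i + j) ^ pair_count (\<rho> i) (\<rho> j)) =
        triple_weight (\<rho> k) (\<rho> (k + 1)) (\<rho> (k + 2))"
      by (simp add: triple_weight_def pair_weight_def power_add mult_ac)
    then show ?thesis unfolding weight_def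
      by (subst prod.subset_diff[OF sub finite_index_pairs]) (simp only:)
  qed
  have "(\<Prod>(i, j)\<in>?A. pair_weight (i + j) ^ pair_count ((\<sigma> \<circ> swap2 k) i) ((\<sigma> \<circ> swap2 k) j)) =
      (\<Prod>(i, j)\<in>?A. pair_weight (i + j) ^ pair_count (\<sigma> i) (\<sigma> j))"
  proof (rule prod.reindex_bij_witness[where i = ?f and j = ?f])
    fix a assume a: "a \<in> ?A"
    then obtain i j where [simp]: "a = (i, j)" and ij: "1 \<le> i" "i < j" "j \<le> int n" "(i, j) \<notin> ?B"
      by (auto simp: index_pairs_def)
    show "?f (?f a) = a" using ij k by auto
    show "?f a \<in> ?A" using ij k by (auto simp: index_pairs_def)
    have "pair_weight (swap2 k i + swap2 k j) = pair_weight (i + j)"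
      by (rule pair_weight_cong) (use ij k in auto)
    then show "(case ?f a of (i, j) \<Rightarrow> pair_weight (i + j) ^ pair_count (\<sigma> i) (\<sigma> j)) =
        (case a of (i, j) \<Rightarrow> pair_weight (i + j) ^ pair_count ((\<sigma> \<circ> swap2 k) i) ((\<sigma> \<circ> swap2 k) j))"
      by simp
  next
    fix a assume a: "a \<in> ?A"
    then obtain i j where [simp]: "a = (i, j)" and ij: "1 \<le> i" "i < j" "j \<le> int n" "(i, j) \<notin> ?B"
      by (auto simp: index_pairs_def)
    show "?f (?f a) = a" using ij k by auto
    show "?f a \<in> ?A" using ij k by (auto simp: index_pairs_def)
  qed
  then show ?thesis using split[of \<sigma>] split[of "\<sigma> \<circ> swap2 k"] k by auto
qed

text \<open>If the middle entry is extremal, exchanging the outer entries preserves the total count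
  of the two neighbouring pairs and changes the count of the outer pair by exactly one.\<close>

lemma weight_swap2_cancel:
  assumes s: "\<sigma> \<in> signed_perms n" and k: "1 \<le> k" "k + 2 \<le> int n"
    and ext: "\<sigma> k < \<sigma> (k + 1) \<and> \<sigma> (k + 2) < \<sigma> (k + 1) \<or>
      \<sigma> (k + 1) < \<sigma> k \<and> \<sigma> (k + 1) < \<sigma> (k + 2)"
  shows "weight n (\<sigma> \<circ> swap2 k) = - weight n \<sigma>"
proof -
  have "\<sigma> k \<noteq> \<sigma> (k + 2)" using signed_perms_inj[OF s] by simp
  then have "triple_weight (\<sigma> (k + 2)) (\<sigma> (k + 1)) (\<sigma> k) =
      - triple_weight (\<sigma> k) (\<sigma> (k + 1)) (\<sigma> (k + 2))"
    using ext unfolding triple_weight_def pair_count_def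
    by (cases "\<sigma> k < \<sigma> (k + 2)"; cases "\<sigma> k + \<sigma> (k + 2) < 0") (auto simp: add.commute)
  then show ?thesis using weight_swap2[OF k, of \<sigma>] by auto
qed


lemma weight_sum_shift:
  assumes k: "1 \<le> k" "k + 2 \<le> int n"
    and J: "\<And>\<sigma>. \<sigma> \<in> signed_perms n \<Longrightarrow> J (\<sigma> \<circ> swap2 k) \<longleftrightarrow> J \<sigma>"
  shows "weight_sum n (\<lambda>\<sigma>. J \<sigma> \<and> \<sigma> k < \<sigma> (k + 1)) =
    weight_sum n (\<lambda>\<sigma>. J \<sigma> \<and> \<sigma> (k + 1) < \<sigma> (k + 2))"
proof -
  \<comment> \<open>\<open>?M\<close> is common to both sides; \<open>?Q\<close> is the remainder
    with a peak at k + 1, \<open>?R\<close> the one with a valley there.\<close>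
  let ?M = "\<lambda>\<sigma>. J \<sigma> \<and> \<sigma> k < \<sigma> (k + 1) \<and> \<sigma> (k + 1) < \<sigma> (k + 2)"
  let ?Q = "\<lambda>\<sigma>. J \<sigma> \<and> \<sigma> k < \<sigma> (k + 1) \<and> \<sigma> (k + 2) < \<sigma> (k + 1)"
  let ?R = "\<lambda>\<sigma>. J \<sigma> \<and> \<sigma> (k + 1) < \<sigma> k \<and> \<sigma> (k + 1) < \<sigma> (k + 2)"
  have ne: "\<sigma> (k + 1) \<noteq> \<sigma> (k + 2)" "\<sigma> k \<noteq> \<sigma> (k + 1)" if "\<sigma> \<in> signed_perms n" for \<sigma>
    using signed_perms_inj[OF that] by auto
  have "weight_sum n ?Q = 0" "weight_sum n ?R = 0"
    by (rule weight_sum_cancel[OF swap2_signed_perms[OF k]];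
        use k J weight_swap2_cancel[OF _ k] in auto)+
  moreover have "weight_sum n (\<lambda>\<sigma>. J \<sigma> \<and> \<sigma> k < \<sigma> (k + 1)) = weight_sum n ?M + weight_sum n ?Q"
    by (rule weight_sum_disj; smt (verit) ne)
  moreover have "weight_sum n (\<lambda>\<sigma>. J \<sigma> \<and> \<sigma> (k + 1) < \<sigma> (k + 2)) =
      weight_sum n ?M + weight_sum n ?R"
    by (rule weight_sum_disj; smt (verit) ne)
  ultimately show ?thesis by simp
qed

section \<open>Sign changes and cancellation among the first three entries\<close>

lemma weight_flip1:
  assumes "\<sigma> \<in> signed_perms n" "1 \<le> n"
  shows "weight n (\<sigma> \<circ> flip 1) = weight n \<sigma>"
  using weight_flip[OF assms(1), of 1] assms(2) by auto

text \<open>Only the pair (1, 2) is affected. Its count goes from 0 to 2, giving (-x)^2, or is 1 for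
  both signs if the first entry dominates.\<close>

lemma weight_flip2:
  assumes s: "\<sigma> \<in> signed_perms n" and n: "2 \<le> n"
  shows "\<bar>\<sigma> 1\<bar> < \<sigma> 2 \<Longrightarrow> weight n (\<sigma> \<circ> flip 2) = monom 1 2 * weight n \<sigma>"
    and "\<bar>\<sigma> 2\<bar> < \<bar>\<sigma> 1\<bar> \<Longrightarrow> weight n (\<sigma> \<circ> flip 2) = weight n \<sigma>"
proof -
  have i: "{1..<2::int} = {1}" by auto
  obtain r where r: "weight n \<sigma> = r * pair_weight 3 ^ pair_count (\<sigma> 1) (\<sigma> 2)"
    "weight n (\<sigma> \<circ> flip 2) = r * pair_weight 3 ^ pair_count (\<sigma> 1) (- \<sigma> 2)"
    using weight_flip[OF s, of 2] n by (auto simp: i)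
  show "\<bar>\<sigma> 1\<bar> < \<sigma> 2 \<Longrightarrow> weight n (\<sigma> \<circ> flip 2) = monom 1 2 * weight n \<sigma>"
    by (simp add: r pair_count_abs_less pair_weight_def monom_power numeral_2_eq_2 mult_monom)
  show "\<bar>\<sigma> 2\<bar> < \<bar>\<sigma> 1\<bar> \<Longrightarrow> weight n (\<sigma> \<circ> flip 2) = weight n \<sigma>"
    by (simp add: r pair_count_abs_less)
qed

text \<open>The affected pairs (1, 3) and (2, 3) have weights -1 and -x. If both counts go from 0 to
  2, the factor is (-1)^2 (-x)^2.\<close>

lemma weight_flip3:
  assumes s: "\<sigma> \<in> signed_perms n" and n: "3 \<le> n"
  shows "\<bar>\<sigma> 1\<bar> < \<sigma> 3 \<Longrightarrow> \<bar>\<sigma> 2\<bar> < \<sigma> 3 \<Longrightarrow> weight n (\<sigma> \<circ> flip 3) = monom 1 2 * weight n \<sigma>"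
    and "\<bar>\<sigma> 3\<bar> < \<bar>\<sigma> 1\<bar> \<Longrightarrow> \<bar>\<sigma> 3\<bar> < \<bar>\<sigma> 2\<bar> \<Longrightarrow> weight n (\<sigma> \<circ> flip 3) = weight n \<sigma>"
proof -
  have i: "{1..<3::int} = {1, 2}" by auto
  obtain r where r: "weight n \<sigma> =
      r * (pair_weight 4 ^ pair_count (\<sigma> 1) (\<sigma> 3) * pair_weight 5 ^ pair_count (\<sigma> 2) (\<sigma> 3))"
    "weight n (\<sigma> \<circ> flip 3) =
      r * (pair_weight 4 ^ pair_count (\<sigma> 1) (- \<sigma> 3) * pair_weight 5 ^ pair_count (\<sigma> 2) (- \<sigma> 3))"
    using weight_flip[OF s, of 3] n by (auto simp: i)
  show "\<bar>\<sigma> 1\<bar> < \<sigma> 3 \<Longrightarrow> \<bar>\<sigma> 2\<bar> < \<sigma> 3 \<Longrightarrow> weight n (\<sigma> \<circ> flip 3) = monom 1 2 * weight n \<sigma>"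
    by (simp add: r pair_count_abs_less pair_weight_def monom_power numeral_2_eq_2 mult_monom)
  show "\<bar>\<sigma> 3\<bar> < \<bar>\<sigma> 1\<bar> \<Longrightarrow> \<bar>\<sigma> 3\<bar> < \<bar>\<sigma> 2\<bar> \<Longrightarrow> weight n (\<sigma> \<circ> flip 3) = weight n \<sigma>"
    by (simp add: r pair_count_abs_less)
qed

text \<open>All three sums are multiples of one sum \<open>?Q\<close>; the two relations result from
  eliminating it. As \<open>J\<close> sees only positions from 4 on, it survives
  \<open>swap2 1\<close> and the first three sign changes.\<close>

lemma weight_sum_prefix:
  assumes n: "3 \<le> n"
    and J: "\<And>\<sigma> \<tau>. (\<And>k. 4 \<le> k \<Longrightarrow> \<sigma> k = \<tau> k) \<Longrightarrow> J \<sigma> \<longleftrightarrow> J \<tau>"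
  shows "(1 - monom 1 2) * weight_sum n (\<lambda>\<sigma>. J \<sigma> \<and> - \<sigma> 2 < \<sigma> 1) = weight_sum n J"
    and "(1 + monom 1 2) * weight_sum n (\<lambda>\<sigma>. J \<sigma> \<and> - \<sigma> 2 < \<sigma> 1) =
      (1 - monom 1 2) * weight_sum n (\<lambda>\<sigma>. J \<sigma> \<and> - \<sigma> 2 < \<sigma> 1 \<and> \<sigma> 1 < \<sigma> 2)"
proof -
  define S where "S P = weight_sum n (\<lambda>\<sigma>. J \<sigma> \<and> P (\<sigma> 1) (\<sigma> 2) (\<sigma> 3))" for P
  let ?x2 = "monom 1 2 :: int poly"
  have Jf: "J (\<sigma> \<circ> flip k) = J \<sigma>" if "\<sigma> \<in> signed_perms n" "1 \<le> k" "k \<le> 3" for \<sigma> k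
    by (rule J) (use that in \<open>simp del: o_apply\<close>)
  have Js: "J (\<sigma> \<circ> swap2 1) = J \<sigma>" for \<sigma>
    by (rule J) simp
  have f: "flip k \<in> signed_perms n" if "1 \<le> k" "k \<le> 3" for k
    by (rule flip_signed_perms) (use that n in auto)
  have sw: "swap2 1 \<in> signed_perms n"
    by (rule swap2_signed_perms) (use n in auto)
  \<comment> \<open>A case split on the first three entries has to be valid only for nonzero
    integers with distinct absolute values.\<close>
  have S_disj: "S P = S Q + S R"
    if "\<And>a b c. a \<noteq> 0 \<Longrightarrow> b \<noteq> 0 \<Longrightarrow> c \<noteq> 0 \<Longrightarrow> \<bar>a\<bar> \<noteq> \<bar>b\<bar> \<Longrightarrow> \<bar>b\<bar> \<noteq> \<bar>c\<bar> \<Longrightarrow> \<bar>a\<bar> \<noteq> \<bar>c\<bar> \<Longrightarrow>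
      (P a b c \<longleftrightarrow> Q a b c \<or> R a b c) \<and> \<not> (Q a b c \<and> R a b c)" for P Q R
    unfolding S_def
  proof (rule weight_sum_disj)
    fix \<sigma> assume s: "\<sigma> \<in> signed_perms n"
    have d: "\<sigma> 1 \<noteq> 0" "\<sigma> 2 \<noteq> 0" "\<sigma> 3 \<noteq> 0"
      "\<bar>\<sigma> 1\<bar> \<noteq> \<bar>\<sigma> 2\<bar>" "\<bar>\<sigma> 2\<bar> \<noteq> \<bar>\<sigma> 3\<bar>" "\<bar>\<sigma> 1\<bar> \<noteq> \<bar>\<sigma> 3\<bar>"
      using signed_perms_range(1)[OF s] signed_perms_abs_inj[OF s] n by auto
    show "J \<sigma> \<and> P (\<sigma> 1) (\<sigma> 2) (\<sigma> 3) \<longleftrightarrow>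
        J \<sigma> \<and> Q (\<sigma> 1) (\<sigma> 2) (\<sigma> 3) \<or> J \<sigma> \<and> R (\<sigma> 1) (\<sigma> 2) (\<sigma> 3)"
      "\<not> ((J \<sigma> \<and> Q (\<sigma> 1) (\<sigma> 2) (\<sigma> 3)) \<and> (J \<sigma> \<and> R (\<sigma> 1) (\<sigma> 2) (\<sigma> 3)))"
      using that[OF d] by auto
  qed
  have S_flip1: "S Q = S P" if "\<And>a b c. Q (- a) b c \<longleftrightarrow> P a b c" for P Q
  proof -
    have "S Q = 1 * S P" unfolding S_def
      by (rule weight_sum_transport[OF f[of 1]])
         (use that Jf weight_flip1 n in \<open>auto simp del: o_apply\<close>)
    then show ?thesis by simp
  qed
  have S_flip2: "S Q = ?x2 * S P"
    if "\<And>a b c. Q a (- b) c \<longleftrightarrow> P a b c" "\<And>a b c. P a b c \<Longrightarrow> \<bar>a\<bar> < b" for P Q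
    unfolding S_def
    by (rule weight_sum_transport[OF f[of 2]])
       (use that Jf weight_flip2(1) n in \<open>auto simp del: o_apply\<close>)
  have S_flip2': "S Q = S P"
    if "\<And>a b c. Q a (- b) c \<longleftrightarrow> P a b c" "\<And>a b c. P a b c \<Longrightarrow> \<bar>b\<bar> < \<bar>a\<bar>" for P Q
  proof -
    have "S Q = 1 * S P" unfolding S_def
      by (rule weight_sum_transport[OF f[of 2]])
         (use that Jf weight_flip2(2) n in \<open>auto simp del: o_apply\<close>)
    then show ?thesis by simp
  qed
  have S_flip3: "S Q = ?x2 * S P"
    if "\<And>a b c. Q a b (- c) \<longleftrightarrow> P a b c" "\<And>a b c. P a b c \<Longrightarrow> \<bar>a\<bar> < c \<and> \<bar>b\<bar> < c" for P Q
    unfolding S_def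
    by (rule weight_sum_transport[OF f[of 3]])
       (use that Jf weight_flip3(1) n in \<open>auto simp del: o_apply\<close>)
  have S_flip3': "S Q = S P"
    if "\<And>a b c. Q a b (- c) \<longleftrightarrow> P a b c" "\<And>a b c. P a b c \<Longrightarrow> \<bar>c\<bar> < \<bar>a\<bar> \<and> \<bar>c\<bar> < \<bar>b\<bar>" for P Q
  proof -
    have "S Q = 1 * S P" unfolding S_def
      by (rule weight_sum_transport[OF f[of 3]])
         (use that Jf weight_flip3(2) n in \<open>auto simp del: o_apply\<close>)
    then show ?thesis by simp
  qed
  have S_cancel: "S P = 0"
    if "\<And>a b c. P c b a \<longleftrightarrow> P a b c" "\<And>a b c. P a b c \<Longrightarrow> a < b \<and> c < b \<or> b < a \<and> b < c" for P
    unfolding S_def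
  proof (rule weight_sum_cancel[OF sw])
    fix \<sigma> assume s: "\<sigma> \<in> signed_perms n"
    show "J (\<sigma> \<circ> swap2 1) \<and> P ((\<sigma> \<circ> swap2 1) 1) ((\<sigma> \<circ> swap2 1) 2) ((\<sigma> \<circ> swap2 1) 3) \<longleftrightarrow>
        J \<sigma> \<and> P (\<sigma> 1) (\<sigma> 2) (\<sigma> 3)"
      using that(1) Js by simp
    assume "J \<sigma> \<and> P (\<sigma> 1) (\<sigma> 2) (\<sigma> 3)"
    then show "weight n (\<sigma> \<circ> swap2 1) = - weight n \<sigma>"
      using that(2)[of "\<sigma> 1" "\<sigma> 2" "\<sigma> 3"] weight_swap2_cancel[OF s, of 1] n by auto
  qed
  let ?E = "S (\<lambda>a b c. 0 < a \<and> a < b \<and> b < c)"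
  \<comment> \<open>Reversing an increasing positive triple raises all three counts from 0 to 1,
    giving (-x)^2 (-1).\<close>
  have rev: "S (\<lambda>a b c. 0 < c \<and> c < b \<and> b < a) = - ?x2 * ?E" unfolding S_def
  proof (rule weight_sum_transport[OF sw])
    fix \<sigma>
    show "J (\<sigma> \<circ> swap2 1) \<and> 0 < (\<sigma> \<circ> swap2 1) 3 \<and> (\<sigma> \<circ> swap2 1) 3 < (\<sigma> \<circ> swap2 1) 2 \<and>
        (\<sigma> \<circ> swap2 1) 2 < (\<sigma> \<circ> swap2 1) 1 \<longleftrightarrow> J \<sigma> \<and> 0 < \<sigma> 1 \<and> \<sigma> 1 < \<sigma> 2 \<and> \<sigma> 2 < \<sigma> 3"
      using Js by simp
    assume a: "J \<sigma> \<and> 0 < \<sigma> 1 \<and> \<sigma> 1 < \<sigma> 2 \<and> \<sigma> 2 < \<sigma> 3"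
    then have "triple_weight (\<sigma> 1) (\<sigma> 2) (\<sigma> 3) = 1" "triple_weight (\<sigma> 3) (\<sigma> 2) (\<sigma> 1) = - ?x2"
      by (simp_all add: triple_weight_def pair_count_def monom_power numeral_2_eq_2 mult_monom)
    then show "weight n (\<sigma> \<circ> swap2 1) = - ?x2 * weight n \<sigma>"
      using weight_swap2[of 1 n \<sigma>] n by auto
  qed
  let ?Q = "S (\<lambda>a b c. \<bar>a\<bar> < b \<and> b < c)"
  let ?A = "S (\<lambda>a b c. \<bar>a\<bar> < b)"
  let ?C = "S (\<lambda>a b c. \<bar>b\<bar> < a)"
  have Q: "?Q = 2 * ?E"
  proof -
    have "?Q = ?E + S (\<lambda>a b c. 0 < - a \<and> - a < b \<and> b < c)" by (rule S_disj) (smt (verit))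
    also have "S (\<lambda>a b c. 0 < - a \<and> - a < b \<and> b < c) = ?E" by (rule S_flip1) auto
    finally show ?thesis by simp
  qed
  \<comment> \<open>Split by the third entry: c > b gives \<open>?Q\<close>, \<bar>c\<bar> < b has a
    peak in the middle and cancels, and c < -b is \<open>?Q\<close> after a sign change with factor
    x^2.\<close>
  have A: "?A = (1 + ?x2) * ?Q"
  proof -
    have "?A = ?Q + S (\<lambda>a b c. \<bar>a\<bar> < b \<and> c < b)" by (rule S_disj) (smt (verit))
    also have "S (\<lambda>a b c. \<bar>a\<bar> < b \<and> c < b) =
        S (\<lambda>a b c. \<bar>a\<bar> < b \<and> \<bar>c\<bar> < b) + S (\<lambda>a b c. \<bar>a\<bar> < b \<and> b < - c)"
      by (rule S_disj) (smt (verit))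
    also have "S (\<lambda>a b c. \<bar>a\<bar> < b \<and> \<bar>c\<bar> < b) = 0" by (rule S_cancel) auto
    also have "S (\<lambda>a b c. \<bar>a\<bar> < b \<and> b < - c) = ?x2 * ?Q" by (rule S_flip3) auto
    finally show ?thesis by (simp add: algebra_simps)
  qed
  \<comment> \<open>For c > \<bar>b\<bar> the middle is a valley. For c < -\<bar>b\<bar> it becomes
    a peak after a free sign change of a. Both cancel. For \<bar>c\<bar> < \<bar>b\<bar> the signs
    of b and c are free, so four copies of the reversed sum \<open>rev\<close> remain.\<close>
  have C: "?C = - (2 * ?x2) * ?Q"
  proof -
    let ?R = "S (\<lambda>a b c. \<bar>c\<bar> < b \<and> b < a)"
    have 1: "S (\<lambda>a b c. \<bar>b\<bar> < a \<and> \<bar>b\<bar> < c) = 0" by (rule S_cancel) auto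
    have 2: "S (\<lambda>a b c. \<bar>b\<bar> < a \<and> \<bar>b\<bar> < - c) = S (\<lambda>a b c. \<bar>b\<bar> < - a \<and> \<bar>b\<bar> < - c)"
      by (rule S_flip1) auto
    have 3: "S (\<lambda>a b c. \<bar>b\<bar> < - a \<and> \<bar>b\<bar> < - c) = 0" by (rule S_cancel) auto
    have 4: "S (\<lambda>a b c. \<bar>c\<bar> < - b \<and> - b < a) = ?R" by (rule S_flip2') auto
    have 6: "?R = S (\<lambda>a b c. 0 < c \<and> c < b \<and> b < a) + S (\<lambda>a b c. 0 < - c \<and> - c < b \<and> b < a)"
      by (rule S_disj) (smt (verit))
    have 5: "S (\<lambda>a b c. 0 < - c \<and> - c < b \<and> b < a) = S (\<lambda>a b c. 0 < c \<and> c < b \<and> b < a)"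
      by (rule S_flip3') auto
    have "?C = S (\<lambda>a b c. \<bar>b\<bar> < a \<and> \<bar>b\<bar> < c) + S (\<lambda>a b c. \<bar>b\<bar> < a \<and> c < \<bar>b\<bar>)"
      by (rule S_disj) (smt (verit))
    also have "S (\<lambda>a b c. \<bar>b\<bar> < a \<and> c < \<bar>b\<bar>) =
        S (\<lambda>a b c. \<bar>b\<bar> < a \<and> \<bar>b\<bar> < - c) + S (\<lambda>a b c. \<bar>c\<bar> < \<bar>b\<bar> \<and> \<bar>b\<bar> < a)"
      by (rule S_disj) (smt (verit))
    also have "S (\<lambda>a b c. \<bar>c\<bar> < \<bar>b\<bar> \<and> \<bar>b\<bar> < a) = ?R + S (\<lambda>a b c. \<bar>c\<bar> < - b \<and> - b < a)"
      by (rule S_disj) (smt (verit))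
    finally show ?thesis
      unfolding 1 2 3 4 6 5 rev Q by simp
  qed
  have c0: "S (\<lambda>a b c. - b < a) = ?A + ?C" by (rule S_disj) (smt (verit))
  \<comment> \<open>The complement a < -b is split by which of the two negative candidates
    dominates: b costs x^2, a is free.\<close>
  have T: "S (\<lambda>a b c. True) = (1 + ?x2) * ?A + 2 * ?C"
  proof -
    have "S (\<lambda>a b c. True) = S (\<lambda>a b c. - b < a) + S (\<lambda>a b c. a < - b)" by (rule S_disj) (smt (verit))
    also have "S (\<lambda>a b c. a < - b) = S (\<lambda>a b c. \<bar>a\<bar> < - b) + S (\<lambda>a b c. \<bar>b\<bar> < - a)"
      by (rule S_disj) (smt (verit))
    also have "S (\<lambda>a b c. \<bar>a\<bar> < - b) = ?x2 * ?A" by (rule S_flip2) auto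
    also have "S (\<lambda>a b c. \<bar>b\<bar> < - a) = ?C" by (rule S_flip1) auto
    finally show ?thesis by (simp add: c0 algebra_simps)
  qed
  \<comment> \<open>The two ascents together say \<bar>a\<bar> < b.\<close>
  have c01: "S (\<lambda>a b c. - b < a \<and> a < b) = ?A"
    unfolding S_def by (rule weight_sum_cong) auto
  have alg: "(1 - x) * ((1 + x) * q + - (2 * x) * q) = (1 + x) * ((1 + x) * q) + 2 * (- (2 * x) * q)"
    "(1 + x) * ((1 + x) * q + - (2 * x) * q) = (1 - x) * ((1 + x) * q)" for x q :: "int poly"
    by (simp_all add: algebra_simps)
  have "(1 - ?x2) * S (\<lambda>a b c. - b < a) = S (\<lambda>a b c. True)"
    unfolding c0 T A C by (rule alg)
  then show "(1 - ?x2) * weight_sum n (\<lambda>\<sigma>. J \<sigma> \<and> - \<sigma> 2 < \<sigma> 1) = weight_sum n J"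
    unfolding S_def simp_thms .
  have "(1 + ?x2) * S (\<lambda>a b c. - b < a) = (1 - ?x2) * S (\<lambda>a b c. - b < a \<and> a < b)"
    unfolding c0 c01 A C by (rule alg)
  then show "(1 + ?x2) * weight_sum n (\<lambda>\<sigma>. J \<sigma> \<and> - \<sigma> 2 < \<sigma> 1) =
      (1 - ?x2) * weight_sum n (\<lambda>\<sigma>. J \<sigma> \<and> - \<sigma> 2 < \<sigma> 1 \<and> \<sigma> 1 < \<sigma> 2)"
    unfolding S_def .
qed

section \<open>Recursion for the sum over the whole group\<close>

lemma signed_perms_Suc_fixed:
  "{\<sigma> \<in> signed_perms (Suc n). \<sigma> (int (Suc n)) = int (Suc n)} = signed_perms n"
proof (intro equalityI subsetI)
  let ?N = "int (Suc n)"
  fix \<sigma> assume a: "\<sigma> \<in> {\<sigma> \<in> signed_perms (Suc n). \<sigma> ?N = ?N}"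
  then have s: "\<sigma> \<in> signed_perms (Suc n)" and N: "\<sigma> ?N = ?N" by auto
  have "\<sigma> permutes ({- ?N..?N} - {0})" using s unfolding signed_perms_def by blast
  moreover have "\<sigma> i = i" if "i \<in> ({- ?N..?N} - {0}) - ({- int n..int n} - {0})" for i
  proof -
    have "i = ?N \<or> i = - ?N" using that by auto
    then show ?thesis using N signed_perms_minus[OF s, of ?N] by metis
  qed
  ultimately have "\<sigma> permutes ({- int n..int n} - {0})"
    by (rule permutes_superset)
  then show "\<sigma> \<in> signed_perms n"
    unfolding signed_perms_def using signed_perms_minus[OF s] by blast
next
  fix \<sigma> assume s: "\<sigma> \<in> signed_perms n"
  then have p: "\<sigma> permutes ({- int n..int n} - {0})" unfolding signed_perms_def by blast
  have "\<sigma> permutes ({- int (Suc n)..int (Suc n)} - {0})"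
    by (rule permutes_subset[OF p]) auto
  moreover have "\<sigma> (int (Suc n)) = int (Suc n)" by (rule permutes_not_in[OF p]) auto
  ultimately show "\<sigma> \<in> {\<sigma> \<in> signed_perms (Suc n). \<sigma> (int (Suc n)) = int (Suc n)}"
    unfolding signed_perms_def using signed_perms_minus[OF s] by blast
qed

lemma signed_perms_abs_less:
  assumes s: "\<sigma> \<in> signed_perms n" and N: "\<bar>\<sigma> k\<bar> = int n" and k: "1 \<le> k"
    and i: "1 \<le> i" "i \<le> int n" "i \<noteq> k"
  shows "\<bar>\<sigma> i\<bar> < int n"
  using signed_perms_abs_inj[OF s i(1) k i(3)] signed_perms_range(2)[OF s i(1,2)] N by simp

text \<open>The last entry exceeds every other absolute value, so all pairs containing it have count
  0.\<close>

lemma weight_Suc_fixed: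
  assumes s: "\<sigma> \<in> signed_perms n"
  shows "weight (Suc n) \<sigma> = weight n \<sigma>"
proof -
  let ?N = "int (Suc n)"
  have s': "\<sigma> \<in> signed_perms (Suc n)" and N: "\<sigma> ?N = ?N"
    using s signed_perms_Suc_fixed[of n] by auto
  show ?thesis unfolding weight_def
  proof (rule prod.mono_neutral_right)
    show "index_pairs n \<subseteq> index_pairs (Suc n)" by (auto simp: index_pairs_def)
    show "\<forall>a\<in>index_pairs (Suc n) - index_pairs n.
        (case a of (i, j) \<Rightarrow> pair_weight (i + j) ^ pair_count (\<sigma> i) (\<sigma> j)) = 1"
    proof
      fix a assume "a \<in> index_pairs (Suc n) - index_pairs n"
      then obtain i where a: "a = (i, ?N)" "1 \<le> i" "i < ?N"
        by (force simp: index_pairs_def)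
      have "\<bar>\<sigma> i\<bar> < ?N" using signed_perms_abs_less[OF s', of ?N i] N a by auto
      then show "(case a of (i, j) \<Rightarrow> pair_weight (i + j) ^ pair_count (\<sigma> i) (\<sigma> j)) = 1"
        using a N by (simp add: pair_count_abs_less)
    qed
  qed simp
qed

lemma weight_sum_Suc_fixed:
  "weight_sum (Suc n) (\<lambda>\<sigma>. \<sigma> (int (Suc n)) = int (Suc n)) = weight_sum n (\<lambda>_. True)"
  using signed_perms_Suc_fixed[of n]
  by (auto simp: weight_sum_def weight_Suc_fixed intro: sum.cong)

text \<open>The exponent counts the odd integers up to n. This is the cost of moving the largest
  entry from the last to the first position, and it supplies the factor with j = n + 1 in the
  product formula.\<close>

lemma prod_pair_weight:
  "(\<Prod>i\<in>{1..int n}. pair_weight i) = monom ((- 1) ^ n) ((n + 1) div 2)"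
proof (induction n)
  case (Suc n)
  have "{1..int (Suc n)} = insert (int (Suc n)) {1..int n}" by auto
  then have "(\<Prod>i\<in>{1..int (Suc n)}. pair_weight i) =
      pair_weight (int (Suc n)) * monom ((- 1) ^ n) ((n + 1) div 2)"
    using Suc by simp
  also have "\<dots> = monom ((- 1) ^ Suc n) ((Suc n + 1) div 2)"
    by (auto simp: pair_weight_def mult_monom minus_monom elim!: evenE oddE)
  finally show ?case .
qed auto

text \<open>With N = n + 1, the substitution i to N - i turns the argument i + N into 2N - i, which
  has the parity of i.\<close>

lemma prod_pair_weight_reflect:
  "(\<Prod>i\<in>{1..<int (Suc n)}. pair_weight (i + int (Suc n))) = (\<Prod>i\<in>{1..int n}. pair_weight i)"
  by (rule prod.reindex_bij_witness[where i = "\<lambda>i. int (Suc n) - i" and j = "\<lambda>i. int (Suc n) - i"])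
     (auto intro!: pair_weight_cong)

text \<open>Composing with it on the right brings the last entry to the front and shifts the others
  one place to the right.\<close>

definition rotation :: "nat \<Rightarrow> int \<Rightarrow> int" where
  "rotation n = odd_extension
     (\<lambda>j. if j = 1 then int (Suc n) else if 2 \<le> j \<and> j \<le> int (Suc n) then j - 1 else j)"

lemma rotation_signed_perms: "rotation n \<in> signed_perms (Suc n)"
  unfolding rotation_def
proof (rule odd_extension_signed_perms, rule bij_imp_permutes)
  let ?p = "\<lambda>j. if j = 1 then int (Suc n) else if 2 \<le> j \<and> j \<le> int (Suc n) then j - 1 else j"
  show "bij_betw ?p {1..int (Suc n)} {1..int (Suc n)}"
    by (rule bij_betw_byWitness[where f' = "\<lambda>j. if j = int (Suc n) then 1 else j + 1"]) auto
qed auto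

lemma rotation_apply:
  "rotation n 1 = int (Suc n)" "1 \<le> j \<Longrightarrow> j \<le> int n \<Longrightarrow> rotation n (j + 1) = j"
  by (auto simp: rotation_def odd_extension_def)

text \<open>Shifting both positions preserves the parity of i + j, so the old pairs give
  \<open>weight n \<sigma>\<close>. Each new pair (1, j + 1) has count 1, since its left entry
  dominates, and index sum of the parity of j.\<close>

lemma weight_rotation:
  assumes s: "\<sigma> \<in> signed_perms n"
  shows "weight (Suc n) (\<sigma> \<circ> rotation n) = (\<Prod>i\<in>{1..int n}. pair_weight i) * weight n \<sigma>"
proof -
  let ?N = "int (Suc n)"
  let ?\<rho> = "\<sigma> \<circ> rotation n"
  let ?f = "\<lambda>(i, j). pair_weight (i + j) ^ pair_count (?\<rho> i) (?\<rho> j)"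
  let ?A = "(\<lambda>j. (1, j + 1)) ` {1..int n}"
  let ?B = "(\<lambda>(i, j). (i + 1, j + 1)) ` index_pairs n"
  have s': "\<sigma> \<in> signed_perms (Suc n)" and N: "\<sigma> ?N = ?N"
    using s signed_perms_Suc_fixed[of n] by auto
  have T: "index_pairs (Suc n) = ?A \<union> ?B"
  proof (intro equalityI subsetI)
    fix a assume "a \<in> index_pairs (Suc n)"
    then obtain i j where a: "a = (i, j)" "1 \<le> i" "i < j" "j \<le> ?N" by (auto simp: index_pairs_def)
    show "a \<in> ?A \<union> ?B"
    proof (cases "i = 1")
      case True
      then have "a \<in> ?A" using a by (intro image_eqI[of _ _ "j - 1"]) auto
      then show ?thesis by simp
    next
      case False
      then have "a \<in> ?B" using a
        by (intro image_eqI[of _ _ "(i - 1, j - 1)"]) (auto simp: index_pairs_def)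
      then show ?thesis by simp
    qed
  qed (auto simp: index_pairs_def)
  have "prod ?f ?A = (\<Prod>j\<in>{1..int n}. pair_weight j)"
  proof -
    have "prod ?f ?A = (\<Prod>j\<in>{1..int n}. ?f (1, j + 1))"
      by (subst prod.reindex) (auto simp: inj_on_def)
    also have "\<dots> = (\<Prod>j\<in>{1..int n}. pair_weight j)"
    proof (rule prod.cong)
      fix j assume j: "j \<in> {1..int n}"
      then have "\<bar>\<sigma> j\<bar> < ?N" using signed_perms_range(2)[OF s, of j] by auto
      then have "pair_count ?N (\<sigma> j) = 1" by (intro pair_count_abs_less) auto
      moreover have "pair_weight (1 + (j + 1)) = pair_weight j" by (rule pair_weight_cong) simp
      ultimately show "?f (1, j + 1) = pair_weight j"
        using j N by (simp add: rotation_apply)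
    qed simp
    finally show ?thesis .
  qed
  moreover have "prod ?f ?B = weight n \<sigma>"
  proof -
    have "prod ?f ?B = (\<Prod>(i, j)\<in>index_pairs n. ?f (i + 1, j + 1))"
      by (subst prod.reindex) (auto simp: inj_on_def case_prod_unfold)
    also have "\<dots> = weight n \<sigma>" unfolding weight_def
    proof (rule prod.cong)
      fix a assume "a \<in> index_pairs n"
      then obtain i j where a: "a = (i, j)" "1 \<le> i" "i < j" "j \<le> int n" by (auto simp: index_pairs_def)
      have "pair_weight ((i + 1) + (j + 1)) = pair_weight (i + j)" by (rule pair_weight_cong) simp
      then show "(case a of (i, j) \<Rightarrow> ?f (i + 1, j + 1)) =
          (case a of (i, j) \<Rightarrow> pair_weight (i + j) ^ pair_count (\<sigma> i) (\<sigma> j))"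
        using a by (simp add: rotation_apply)
    qed simp
    finally show ?thesis .
  qed
  moreover have "?A \<inter> ?B = {}" by (auto simp: index_pairs_def)
  ultimately show ?thesis
    unfolding weight_def[of "Suc n"] T by (subst prod.union_disjoint) auto
qed

lemma weight_sum_by_position:
  assumes n: "1 \<le> n"
  shows "weight_sum n (\<lambda>_. True) = (\<Sum>p\<in>{1..int n}. weight_sum n (\<lambda>\<sigma>. \<bar>\<sigma> p\<bar> = int n))"
proof -
  let ?g = "\<lambda>\<sigma>. \<bar>inv \<sigma> (int n)\<bar>"
  have g: "?g \<sigma> = p \<longleftrightarrow> \<bar>\<sigma> p\<bar> = int n" if s: "\<sigma> \<in> signed_perms n" and p: "1 \<le> p" for \<sigma> p
  proof -
    have P: "\<sigma> permutes ({- int n..int n} - {0})" using s by (simp add: signed_perms_def)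
    have "?g \<sigma> = p \<longleftrightarrow> inv \<sigma> (int n) = p \<or> inv \<sigma> (int n) = - p" using p by auto
    also have "\<dots> \<longleftrightarrow> int n = \<sigma> p \<or> int n = \<sigma> (- p)"
      using permutes_inv_eq[OF P] by auto
    finally show ?thesis using signed_perms_minus[OF s] by auto
  qed
  have "weight_sum n (\<lambda>_. True) =
      (\<Sum>p\<in>{1..int n}. \<Sum>\<sigma> | \<sigma> \<in> signed_perms n \<and> ?g \<sigma> = p. weight n \<sigma>)"
    unfolding weight_sum_def simp_thms
  proof (subst sum.group)
    show "?g ` signed_perms n \<subseteq> {1..int n}"
    proof clarify
      fix \<sigma> assume "\<sigma> \<in> signed_perms n"
      then have i: "inv \<sigma> \<in> signed_perms n" by (rule signed_perms_inv)
      then show "?g \<sigma> \<in> {1..int n}" using signed_perms_range[OF i, of "int n"] n by auto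
    qed
  qed auto
  also have "\<dots> = (\<Sum>p\<in>{1..int n}. weight_sum n (\<lambda>\<sigma>. \<bar>\<sigma> p\<bar> = int n))"
    unfolding weight_sum_def using g by (intro sum.cong) auto
  finally show ?thesis .
qed

text \<open>Write N = n + 1 and e for the product of \<open>prod_pair_weight\<close>. In units of
  the smaller total, N last contributes 1, -N last e^2, and N and -N first e each; all other places
  of the largest absolute value cancel.\<close>

lemma weight_sum_Suc:
  assumes n: "1 \<le> n"
  shows "weight_sum (Suc n) (\<lambda>_. True) =
    (1 + monom ((- 1) ^ n) (Suc n div 2))\<^sup>2 * weight_sum n (\<lambda>_. True)"
proof -
  let ?N = "int (Suc n)"
  let ?e = "\<Prod>i\<in>{1..int n}. pair_weight i"
  let ?T = "weight_sum n (\<lambda>_. True)"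
  have split: "weight_sum (Suc n) (\<lambda>\<sigma>. \<bar>\<sigma> p\<bar> = ?N) =
      weight_sum (Suc n) (\<lambda>\<sigma>. \<sigma> p = ?N) + weight_sum (Suc n) (\<lambda>\<sigma>. - \<sigma> p = ?N)" for p
    by (rule weight_sum_disj) auto
  have last: "weight_sum (Suc n) (\<lambda>\<sigma>. - \<sigma> ?N = ?N) = ?e\<^sup>2 * weight_sum (Suc n) (\<lambda>\<sigma>. \<sigma> ?N = ?N)"
  proof (rule weight_sum_transport[OF flip_signed_perms[of ?N]])
    fix \<sigma> assume s: "\<sigma> \<in> signed_perms (Suc n)"
    show "- (\<sigma> \<circ> flip ?N) ?N = ?N \<longleftrightarrow> \<sigma> ?N = ?N"
      using s by (simp del: o_apply)
    assume N: "\<sigma> ?N = ?N"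
    have less: "\<bar>\<sigma> i\<bar> < ?N" if "i \<in> {1..<?N}" for i
      using signed_perms_abs_less[OF s, of ?N i] that N by auto
    obtain r where r: "weight (Suc n) \<sigma> =
        r * (\<Prod>i\<in>{1..<?N}. pair_weight (i + ?N) ^ pair_count (\<sigma> i) (\<sigma> ?N))"
      "weight (Suc n) (\<sigma> \<circ> flip ?N) =
        r * (\<Prod>i\<in>{1..<?N}. pair_weight (i + ?N) ^ pair_count (\<sigma> i) (- \<sigma> ?N))"
      using weight_flip[OF s, of ?N] by auto
    have 0: "(\<Prod>i\<in>{1..<?N}. pair_weight (i + ?N) ^ pair_count (\<sigma> i) (\<sigma> ?N)) = 1"
      unfolding N by (rule prod.neutral) (use less in \<open>auto simp: pair_count_abs_less\<close>)
    have "(\<Prod>i\<in>{1..<?N}. pair_weight (i + ?N) ^ pair_count (\<sigma> i) (- \<sigma> ?N)) =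
        (\<Prod>i\<in>{1..<?N}. (pair_weight (i + ?N))\<^sup>2)"
      unfolding N by (rule prod.cong) (use less in \<open>auto simp only: pair_count_abs_less\<close>)
    also have "\<dots> = ?e\<^sup>2"
      by (simp only: prod_power_distrib[symmetric] prod_pair_weight_reflect)
    finally show "weight (Suc n) (\<sigma> \<circ> flip ?N) = ?e\<^sup>2 * weight (Suc n) \<sigma>"
      using r 0 by simp
  qed auto
  have first: "weight_sum (Suc n) (\<lambda>\<sigma>. \<sigma> 1 = ?N) = ?e * weight_sum (Suc n) (\<lambda>\<sigma>. \<sigma> ?N = ?N)"
  proof (rule weight_sum_transport[OF rotation_signed_perms])
    fix \<sigma> assume s: "\<sigma> \<in> signed_perms (Suc n)"
    show "(\<sigma> \<circ> rotation n) 1 = ?N \<longleftrightarrow> \<sigma> ?N = ?N" by (simp add: rotation_apply)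
    assume "\<sigma> ?N = ?N"
    then have "\<sigma> \<in> signed_perms n" using s signed_perms_Suc_fixed[of n] by auto
    then show "weight (Suc n) (\<sigma> \<circ> rotation n) = ?e * weight (Suc n) \<sigma>"
      using weight_rotation weight_Suc_fixed by simp
  qed
  have first': "weight_sum (Suc n) (\<lambda>\<sigma>. - \<sigma> 1 = ?N) = 1 * weight_sum (Suc n) (\<lambda>\<sigma>. \<sigma> 1 = ?N)"
    by (rule weight_sum_transport[OF flip_signed_perms[of 1]])
       (use weight_flip1 in \<open>auto simp del: o_apply\<close>)
  \<comment> \<open>Here the entry at p is larger or smaller than both neighbours, so exchanging the
    neighbours reverses the sign.\<close>
  have middle: "weight_sum (Suc n) (\<lambda>\<sigma>. \<bar>\<sigma> p\<bar> = ?N) = 0" if p: "2 \<le> p" "p \<le> int n" for p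
  proof (rule weight_sum_cancel[OF swap2_signed_perms[of "p - 1"]])
    fix \<sigma> assume s: "\<sigma> \<in> signed_perms (Suc n)"
    show "\<bar>(\<sigma> \<circ> swap2 (p - 1)) p\<bar> = ?N \<longleftrightarrow> \<bar>\<sigma> p\<bar> = ?N" using p by simp
    assume N: "\<bar>\<sigma> p\<bar> = ?N"
    have "\<bar>\<sigma> (p - 1)\<bar> < ?N" "\<bar>\<sigma> (p + 1)\<bar> < ?N"
      by (rule signed_perms_abs_less[OF s N]; use p in auto)+
    moreover have "p - 1 + 1 = p" "p - 1 + 2 = p + 1" by auto
    ultimately show "weight (Suc n) (\<sigma> \<circ> swap2 (p - 1)) = - weight (Suc n) \<sigma>"
      using N p by (intro weight_swap2_cancel[OF s]) (simp_all only:, linarith+)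
  qed (use p in auto)
  have "weight_sum (Suc n) (\<lambda>_. True) = (\<Sum>p\<in>{1..?N}. weight_sum (Suc n) (\<lambda>\<sigma>. \<bar>\<sigma> p\<bar> = ?N))"
    by (rule weight_sum_by_position) simp
  also have "\<dots> = (\<Sum>p\<in>{1, ?N}. weight_sum (Suc n) (\<lambda>\<sigma>. \<bar>\<sigma> p\<bar> = ?N))"
    by (rule sum.mono_neutral_right) (use middle in auto)
  also have "\<dots> = weight_sum (Suc n) (\<lambda>\<sigma>. \<bar>\<sigma> 1\<bar> = ?N) + weight_sum (Suc n) (\<lambda>\<sigma>. \<bar>\<sigma> ?N\<bar> = ?N)"
    using n by (subst sum.insert) auto
  also have "\<dots> = (1 + ?e)\<^sup>2 * ?T"
    unfolding split last first first' weight_sum_Suc_fixed by (simp add: power2_eq_square algebra_simps)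
  finally show ?thesis by (simp add: prod_pair_weight)
qed

lemma weight_sum_1: "weight_sum 1 (\<lambda>_. True) = 2"
proof -
  have "weight_sum 1 (\<lambda>_. True) = weight_sum 1 (\<lambda>\<sigma>. \<sigma> 1 = 1) + weight_sum 1 (\<lambda>\<sigma>. - \<sigma> 1 = 1)"
  proof (rule weight_sum_disj)
    fix \<sigma> assume s: "\<sigma> \<in> signed_perms 1"
    then show "True \<longleftrightarrow> \<sigma> 1 = 1 \<or> - \<sigma> 1 = 1" using signed_perms_range[OF s, of 1] by auto
  qed auto
  moreover have "weight_sum 1 (\<lambda>\<sigma>. - \<sigma> 1 = 1) = 1 * weight_sum 1 (\<lambda>\<sigma>. \<sigma> 1 = 1)"
    by (rule weight_sum_transport[OF flip_signed_perms[of 1]])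
       (use weight_flip1 in \<open>auto simp del: o_apply\<close>)
  moreover have "weight_sum 1 (\<lambda>\<sigma>. \<sigma> 1 = 1) = weight_sum 0 (\<lambda>_. True)"
    using weight_sum_Suc_fixed[of 0] by simp
  moreover have "signed_perms 0 = {id}"
    by (auto simp: signed_perms_def)
  moreover have "index_pairs 0 = {}" by (auto simp: index_pairs_def)
  ultimately show ?thesis by (simp add: weight_sum_def weight_def)
qed

text \<open>The leading 2 is the value for n = 1; it matches the doubling in
  \<open>weight_sum_eq_D_gf\<close>.\<close>

lemma weight_sum_total:
  assumes "1 \<le> n"
  shows "weight_sum n (\<lambda>_. True) =
    2 * (\<Prod>j = 2..n. (1 + monom ((- 1) ^ (j - 1)) (j div 2))\<^sup>2)"
  using assms
proof (induction n rule: dec_induct)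
  case base
  then show ?case using weight_sum_1 by simp
next
  case (step n)
  then have "{2..Suc n} = insert (Suc n) {2..n}" by auto
  then show ?case using step weight_sum_Suc[of n] by simp
qed


section \<open>Weight versus the two lengths, and restriction to even signed permutations\<close>

lemma prod_monom:
  "(\<Prod>x\<in>A. monom (f x) (g x)) = (monom (\<Prod>x\<in>A. f x) (\<Sum>x\<in>A. g x) :: int poly)"
  by (induction A rule: infinite_finite_induct) (auto simp: mult_monom)

lemma card_index_pairs:
  "card {(i, j) \<in> {1..int n} \<times> {1..int n}. i < j \<and> R i j} =
    (\<Sum>(i, j)\<in>index_pairs n. of_bool (R i j))"
proof -
  have "{(i, j) \<in> {1..int n} \<times> {1..int n}. i < j \<and> R i j} =
      index_pairs n \<inter> {p. case p of (i, j) \<Rightarrow> R i j}"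
    by (auto simp: index_pairs_def)
  then show ?thesis
    by (simp add: case_prod_unfold)
qed

lemma monom_coxeter_odd_length:
  "monom ((- 1) ^ coxeter_length n \<sigma>) (odd_length n \<sigma>) = weight n \<sigma>"
proof -
  let ?c = "\<lambda>(i, j). pair_count (\<sigma> i) (\<sigma> j)"
  have "coxeter_length n \<sigma> = sum ?c (index_pairs n)"
    unfolding coxeter_length_def card_index_pairs sum.distrib[symmetric]
    by (intro sum.cong) (auto simp: pair_count_def)
  moreover have "odd_length n \<sigma> =
      (\<Sum>p\<in>index_pairs n. if odd (fst p + snd p) then ?c p else 0)"
  proof -
    have parity: "i mod 2 \<noteq> j mod 2 \<longleftrightarrow> odd (i + j)" for i j :: int by presburger
    show ?thesis
      unfolding odd_length_def parity card_index_pairs sum.distrib[symmetric]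
      by (intro sum.cong) (auto simp: pair_count_def)
  qed
  moreover have "weight n \<sigma> = (\<Prod>p\<in>index_pairs n.
      monom ((- 1) ^ ?c p) (if odd (fst p + snd p) then ?c p else 0))"
  proof -
    have "pair_weight k ^ c = monom ((- 1) ^ c) (if odd k then c else 0)" for k c
    proof -
      have "pair_weight k = monom (- 1) (if odd k then 1 else 0)"
        by (simp add: pair_weight_def flip: minus_monom)
      then show ?thesis by (simp add: monom_power)
    qed
    then show ?thesis unfolding weight_def by (intro prod.cong) auto
  qed
  ultimately show ?thesis by (simp add: prod_monom power_sum)
qed

text \<open>Only \<plusminus>1 is moved, and the other number then has absolute value at least 2,
  which alone decides each comparison.\<close>

lemma flip1_less:
  assumes "a \<noteq> 0" "b \<noteq> 0" "\<bar>a\<bar> \<noteq> \<bar>b\<bar>"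
  shows "flip 1 a < flip 1 b \<longleftrightarrow> a < b" "flip 1 a + flip 1 b < 0 \<longleftrightarrow> a + b < 0"
    "- flip 1 a < flip 1 b \<longleftrightarrow> - a < b"
  using assms by (auto simp: flip_def transpose_def)

text \<open>Changing the sign of the value \<open>\<plusminus>1\<close> exchanges \<open>\<D>\<^sub>n\<close> with its complement and
  affects no comparison.\<close>

lemma weight_sum_eq_D_gf:
  assumes n: "2 \<le> n" and I: "I \<subseteq> {..<n}"
  shows "weight_sum n (\<lambda>\<sigma>. \<forall>i\<in>I. value_at \<sigma> i < value_at \<sigma> (i + 1)) = 2 * D_gf n I"
proof -
  let ?P = "\<lambda>\<sigma>. \<forall>i\<in>I. value_at \<sigma> i < value_at \<sigma> (i + 1)"
  let ?E = "\<lambda>\<sigma>. even (card {i \<in> {1..int n}. \<sigma> i < 0})"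
  \<comment> \<open>Composition on the left acts on values, unlike the position changes used so
    far.\<close>
  let ?h = "\<lambda>\<sigma>. flip 1 \<circ> \<sigma>"
  have h: "flip 1 \<in> signed_perms n" by (rule flip_signed_perms) (use n in auto)
  have hh: "?h (?h \<sigma>) = \<sigma>" for \<sigma> by (auto simp: flip_def fun_eq_iff)
  have hs: "?h \<sigma> \<in> signed_perms n" if "\<sigma> \<in> signed_perms n" for \<sigma>
    by (rule signed_perms_comp[OF h that])
  have less: "?h \<sigma> i < ?h \<sigma> j \<longleftrightarrow> \<sigma> i < \<sigma> j" "?h \<sigma> i + ?h \<sigma> j < 0 \<longleftrightarrow> \<sigma> i + \<sigma> j < 0"
    "- ?h \<sigma> i < ?h \<sigma> j \<longleftrightarrow> - \<sigma> i < \<sigma> j"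
    if s: "\<sigma> \<in> signed_perms n" and ij: "1 \<le> i" "i \<le> int n" "1 \<le> j" "j \<le> int n" "i \<noteq> j"
    for \<sigma> i j
    using flip1_less[of "\<sigma> i" "\<sigma> j"] signed_perms_range(1)[OF s] signed_perms_abs_inj[OF s] ij
    by auto
  have hw: "weight n (?h \<sigma>) = weight n \<sigma>" if s: "\<sigma> \<in> signed_perms n" for \<sigma>
    unfolding weight_def
    by (rule prod.cong)
       (use less[OF s] in \<open>auto simp: index_pairs_def pair_count_def simp del: o_apply\<close>)
  have hP: "?P (?h \<sigma>) \<longleftrightarrow> ?P \<sigma>" if s: "\<sigma> \<in> signed_perms n" for \<sigma>
  proof (rule ball_cong[OF refl])
    fix i assume "i \<in> I"
    then have "i < n" using I by auto
    then show "value_at (?h \<sigma>) i < value_at (?h \<sigma>) (i + 1) \<longleftrightarrow> value_at \<sigma> i < value_at \<sigma> (i + 1)"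
      using less[OF s] n by (cases "i = 0") (auto simp: value_at_def simp del: o_apply)
  qed
  have hE: "?E (?h \<sigma>) \<longleftrightarrow> \<not> ?E \<sigma>" if s: "\<sigma> \<in> signed_perms n" for \<sigma>
  proof -
    \<comment> \<open>The position carrying \<plusminus>1. It is the only positive position whose
      sign changes, so the number of negative entries changes by one.\<close>
    define p where "p = \<bar>inv \<sigma> 1\<bar>"
    have P: "\<sigma> permutes ({- int n..int n} - {0})" using s by (simp add: signed_perms_def)
    have i: "inv \<sigma> \<in> signed_perms n" by (rule signed_perms_inv[OF s])
    have p: "1 \<le> p" "p \<le> int n" using signed_perms_range[OF i, of 1] n by (auto simp: p_def)
    have "\<sigma> (inv \<sigma> 1) = 1" using permutes_inverses[OF P] by simp
    then have sp: "\<bar>\<sigma> p\<bar> = 1"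
      using signed_perms_minus[OF s] by (auto simp: p_def abs_if)
    have other: "?h \<sigma> j < 0 \<longleftrightarrow> \<sigma> j < 0" if "1 \<le> j" "j \<noteq> p" for j
      using signed_perms_abs_inj[OF s, of j p] that p sp by (auto simp: flip_def transpose_def)
    have atp: "?h \<sigma> p < 0 \<longleftrightarrow> \<not> \<sigma> p < 0"
      using sp by (auto simp: flip_def transpose_def)
    let ?M = "\<lambda>\<rho>::int \<Rightarrow> int. {i \<in> {1..int n} - {p}. \<rho> i < 0}"
    have card: "card {i \<in> {1..int n}. \<rho> i < 0} = of_bool (\<rho> p < 0) + card (?M \<rho>)" for \<rho> :: "int \<Rightarrow> int"
    proof -
      have "{i \<in> {1..int n}. \<rho> i < 0} = (if \<rho> p < 0 then insert p (?M \<rho>) else ?M \<rho>)"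
        using p by auto
      moreover have "finite (?M \<rho>)" "p \<notin> ?M \<rho>"
        by (auto intro: finite_subset[of _ "{1..int n}"])
      ultimately show ?thesis by (simp only: if_split card_insert_disjoint of_bool_def) simp
    qed
    have "?M (?h \<sigma>) = ?M \<sigma>" using other by auto
    then show ?thesis unfolding card using atp by auto
  qed
  have "(\<Sum>\<sigma> | \<sigma> \<in> signed_perms n \<and> ?P \<sigma> \<and> \<not> ?E \<sigma>. weight n \<sigma>) =
      (\<Sum>\<sigma> | \<sigma> \<in> signed_perms n \<and> ?P \<sigma> \<and> ?E \<sigma>. weight n \<sigma>)"
    by (rule sum.reindex_bij_witness[where i = ?h and j = ?h])
       (use hh hs hw hP hE in \<open>auto simp del: o_apply\<close>)
  then have "weight_sum n (\<lambda>\<sigma>. ?P \<sigma> \<and> \<not> ?E \<sigma>) = weight_sum n (\<lambda>\<sigma>. ?P \<sigma> \<and> ?E \<sigma>)"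
    unfolding weight_sum_def .
  moreover have "weight_sum n ?P = weight_sum n (\<lambda>\<sigma>. ?P \<sigma> \<and> ?E \<sigma>) + weight_sum n (\<lambda>\<sigma>. ?P \<sigma> \<and> \<not> ?E \<sigma>)"
    by (rule weight_sum_disj) auto
  moreover have "D_gf n I = weight_sum n (\<lambda>\<sigma>. ?P \<sigma> \<and> ?E \<sigma>)"
    unfolding D_gf_def weight_sum_def monom_coxeter_odd_length
    by (rule sum.cong) (auto simp: D_quotient_def even_signed_perms_def)
  ultimately show ?thesis by simp
qed

section \<open>Moving ascents over several positions and assembling the two formulas\<close>

lemma weight_sum_ascent_eq:
  assumes "a \<le> b" "1 \<le> a" "b + 1 \<le> int n"
    and J: "\<And>\<sigma> k. \<sigma> \<in> signed_perms n \<Longrightarrow> a \<le> k \<Longrightarrow> J (\<sigma> \<circ> swap2 k) \<longleftrightarrow> J \<sigma>"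
  shows "weight_sum n (\<lambda>\<sigma>. J \<sigma> \<and> \<sigma> b < \<sigma> (b + 1)) =
    weight_sum n (\<lambda>\<sigma>. J \<sigma> \<and> \<sigma> a < \<sigma> (a + 1))"
  using assms(1,3)
proof (induction b rule: int_ge_induct)
  case (step b)
  have "weight_sum n (\<lambda>\<sigma>. J \<sigma> \<and> \<sigma> b < \<sigma> (b + 1)) =
      weight_sum n (\<lambda>\<sigma>. J \<sigma> \<and> \<sigma> (b + 1) < \<sigma> (b + 2))"
    by (rule weight_sum_shift) (use step assms(2) J in auto)
  then show ?case using step by (simp add: add.assoc)
qed simp

theorem corollary5p11:
  fixes n i :: nat
  assumes "n \<ge> 5" and "3 \<le> i" and "i \<le> n - 1"
  shows "D_gf n {0, i} =
           (\<Prod>j = 4..n. (1 + monom ((- 1) ^ (j - 1)) (j div 2)) ^ 2)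
       \<and> D_gf n {0, 1, i} =
           (1 - monom 1 4) * (\<Prod>j = 5..n. (1 + monom ((- 1) ^ (j - 1)) (j div 2)) ^ 2)"
proof -
  let ?x2 = "monom 1 2 :: int poly"
  let ?F = "\<lambda>j. (1 + monom ((- 1) ^ (j - 1)) (j div 2) :: int poly)\<^sup>2"
  define T where "T = weight_sum n (\<lambda>_. True)"
  define A where "A k = weight_sum n (\<lambda>\<sigma>. \<sigma> k < \<sigma> (k + 1))" for k
  define U where "U k = weight_sum n (\<lambda>\<sigma>. - \<sigma> 2 < \<sigma> 1 \<and> \<sigma> k < \<sigma> (k + 1))" for k
  define V where "V k = weight_sum n (\<lambda>\<sigma>. (- \<sigma> 2 < \<sigma> 1 \<and> \<sigma> 1 < \<sigma> 2) \<and> \<sigma> k < \<sigma> (k + 1))" for k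
  have i: "3 \<le> int i" "int i + 1 \<le> int n" using assms by auto
  \<comment> \<open>The ascent is moved down to 3, where the exchanges still avoid positions 1 and
    2, and from 3 up to 4. There it concerns only positions from 4 on, as
    \<open>weight_sum_prefix\<close> requires; n \<ge> 5 makes room for it.\<close>
  have UV: "U (int i) = U 4" "V (int i) = V 4"
  proof -
    have "U b = U 3" "V b = V 3" if "3 \<le> b" "b + 1 \<le> int n" for b
      unfolding U_def V_def by (rule weight_sum_ascent_eq; use that in simp)+
    from this[of "int i"] this[of 4] i assms(1)
    show "U (int i) = U 4" "V (int i) = V 4" by simp_all
  qed
  have A41: "A 4 = A 1"
    using weight_sum_ascent_eq[of 1 4 n "\<lambda>_. True"] assms(1) by (simp add: A_def)
  \<comment> \<open>Changing the sign of the first entry is free and turns the ascent at 1 into the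
    ascent at 0.\<close>
  have A1: "A 1 = weight_sum n (\<lambda>\<sigma>. - \<sigma> 2 < \<sigma> 1)"
  proof -
    have "A 1 = 1 * weight_sum n (\<lambda>\<sigma>. - \<sigma> 2 < \<sigma> 1)" unfolding A_def
      by (rule weight_sum_transport[OF flip_signed_perms[of 1]])
         (use weight_flip1 assms(1) in \<open>auto simp del: o_apply\<close>)
    then show ?thesis by simp
  qed
  \<comment> \<open>The prefix relations are applied with the trivial \<open>J\<close> and with the
    ascent at 4. Through \<open>A41\<close> they chain to (1 - x^2)^2 \<open>U 4\<close> =
    \<open>T\<close>.\<close>
  have T1: "(1 - ?x2) * A 1 = T"
    using weight_sum_prefix(1)[of n "\<lambda>_. True"] assms(1) by (simp add: A1 T_def)
  have U4: "(1 - ?x2) * U 4 = A 4"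
    using weight_sum_prefix(1)[of n "\<lambda>\<sigma>. \<sigma> 4 < \<sigma> 5"] assms(1)
    by (simp add: U_def A_def conj_commute)
  have V4: "(1 + ?x2) * U 4 = (1 - ?x2) * V 4"
    using weight_sum_prefix(2)[of n "\<lambda>\<sigma>. \<sigma> 4 < \<sigma> 5"] assms(1)
    by (simp add: U_def V_def conj_commute conj_left_commute)
  have ne: "1 - ?x2 \<noteq> 0"
  proof
    assume "1 - ?x2 = 0"
    then have "coeff (1 - ?x2) 0 = 0" by (simp only: coeff_0)
    then show False by simp
  qed
  have x2: "?x2 = monom 1 1 * monom 1 1" "monom 1 4 = ?x2 * ?x2"
    unfolding mult_monom by (simp_all only: mult_1 numeral_plus_numeral one_add_one add_num_simps)
  \<comment> \<open>The factors for j = 2 and j = 3 multiply to (1 - x^2)^2 and cancel, which is why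
    the first product starts at 4.\<close>
  have "?F 2 = (1 - monom 1 1)\<^sup>2" "?F 3 = (1 + monom 1 1)\<^sup>2"
    and F4: "?F 4 = (1 - ?x2)\<^sup>2"
    by (simp_all flip: minus_monom)
  then have F23: "?F 2 * ?F 3 = (1 - ?x2)\<^sup>2"
    by (simp only: x2(1)) (simp add: power2_eq_square algebra_simps)
  have "(1 - ?x2)\<^sup>2 * U 4 = 2 * prod ?F {2..n}"
    using T1 U4 A41 weight_sum_total[of n] assms(1)
    by (simp add: T_def power2_eq_square mult.assoc)
  also have "{2..n} = insert 2 (insert 3 {4..n})" using assms(1) by auto
  also have "2 * prod ?F \<dots> = (1 - ?x2)\<^sup>2 * (2 * prod ?F {4..n})"
    by (simp add: F23[symmetric] mult_ac)
  finally have U: "U 4 = 2 * prod ?F {4..n}" using ne by simp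
  have "{4..n} = insert 4 {5..n}" using assms(1) by auto
  then have "prod ?F {4..n} = ?F 4 * prod ?F {5..n}" by (simp only:) (rule prod.insert, auto)
  then have p4: "prod ?F {4..n} = (1 - ?x2)\<^sup>2 * prod ?F {5..n}" unfolding F4 .
  \<comment> \<open>Used with x^2 for x: the factor for j = 4 absorbs 1 + x^2 into 1 - x^4, and one
    factor 1 - x^2 is left over to cancel.\<close>
  have "(1 + x) * (2 * ((1 - x)\<^sup>2 * p)) = (1 - x) * (2 * ((1 - x * x) * p))" for x p :: "int poly"
    by (simp add: power2_eq_square algebra_simps)
  then have "(1 - ?x2) * V 4 = (1 - ?x2) * (2 * ((1 - monom 1 4) * prod ?F {5..n}))"
    unfolding V4[symmetric] U p4 x2(2) .
  then have V: "V 4 = 2 * ((1 - monom 1 4) * prod ?F {5..n})" using ne by simp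
  have n: "2 \<le> n" and small: "{0, i} \<subseteq> {..<n}" "{0, 1, i} \<subseteq> {..<n}"
    using assms by auto
  have "2 * D_gf n {0, i} = U (int i)"
    unfolding weight_sum_eq_D_gf[OF n small(1), symmetric] using assms(2)
    by (simp add: U_def value_at_def add.commute)
  moreover have "2 * D_gf n {0, 1, i} = V (int i)"
    unfolding weight_sum_eq_D_gf[OF n small(2), symmetric] using assms(2)
    by (simp add: V_def value_at_def add.commute conj_assoc)
  ultimately show ?thesis unfolding UV U V by simp
qed

end
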